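(* Let $\mathbf{R}(\mathbf{u})=\mathbf{A}\mathbf{u}$ be a linear time-invariant operator, with $\mathbf{A}\in\mathbb{R}^{N\times N}$ constant, let $\mathbf{u}_F:[0,T]\to\mathbb{R}^N$ solve $\frac{d\mathbf{u}_F}{dt}=\mathbf{A}\mathbf{u}_F$, $\mathbf{u}_F(0)=\mathbf{u}_0$, and let $\tilde{\mathbf{u}}_F=\tilde{\Pi}\mathbf{u}_F$. In the limit $\tau\to0^+$, the upper bound $B_A(\tau,t)$ on the projected full-order coarse-scale residual for the Adjoint Petrov--Galerkin (APG) method is less per unit $\tau$ than the corresponding upper bound $B_G(\tau,t)$ for the Galerkin method (both bounds are defined in the context), in the sense that, for $t\in(0,T]$, $$\lim_{\tau\to0^+}\frac1\tau\left[\Big\|\tilde{\mathbf{V}}^T\mathbf{A}\int_0^{\tau}e^{\Pi'\mathbf{A}\zeta}\Pi'\mathbf{A}\tilde{\mathbf{u}}_F(t-\zeta)\,d\zeta-\tau\tilde{\mathbf{V}}^T\mathbf{A}\Pi'\mathbf{A}\tilde{\mathbf{u}}_F(t)\Big\|_2+\Big\|\tilde{\mathbf{V}}^T\mathbf{A}\int_{\tau}^{t}e^{\Pi'\mathbf{A}\zeta}\Pi'\mathbf{A}\tilde{\mathbf{u}}_F(t-\zeta)\,d\zeta\Big\|_2\right]$$ $$\le\ \lim_{\tau\to0^+}\frac1\tau\left[\Big\|\tilde{\mathbf{V}}^T\mathbf{A}\int_0^{\tau}e^{\Pi'\mathbf{A}\zeta}\Pi'\mathbf{A}\tilde{\ma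thbf{u}}_F(t-\zeta)\,d\zeta\Big\|_2+\Big\|\tilde{\mathbf{V}}^T\mathbf{A}\int_{\tau}^{t}e^{\Pi'\mathbf{A}\zeta}\Pi'\mathbf{A}\tilde{\mathbf{u}}_F(t-\zeta)\,d\zeta\Big\|_2\right].$$
   Context: $N,K$ are positive integers with $K\le N$ (in practice $K\ll N$), and $T>0$. $\tilde{\mathbf{V}}\in\mathbb{R}^{N\times K}$ is a matrix with orthonormal columns (the coarse-scale trial basis), $\tilde{\Pi}=\tilde{\mathbf{V}}\tilde{\mathbf{V}}^T$ and $\Pi'=\mathbf{I}-\tilde{\mathbf{V}}\tilde{\mathbf{V}}^T$. The initial condition satisfies $\mathbf{u}_0\in\mathrm{Range}(\tilde{\mathbf{V}})$. $e^{\Pi'\mathbf{A}\zeta}$ is the matrix exponential and $\|\cdot\|_2$ is the Euclidean norm. The parameter $\tau$ is the memory length of the APG method. The Galerkin and APG reduced-order models are $\frac{d\tilde{\mathbf{u}}_G}{dt}=\mathbb{P}_G\mathbf{A}\tilde{\mathbf{u}}_G$ and $\frac{d\tilde{\mathbf{u}}_A}{dt}=\mathbb{P}_A\mathbf{A}\tilde{\mathbf{u}}_A$, both with initial value $\mathbf{u}_0$, where $\mathbb{P}_G=\tilde{\Pi}$ and $\mathbb{P}_A=\tilde{\Pi}[\mathbf{I}+\tau\mathbf{A}\Pi']$. The full-order residual is $\mathbf{r}_F(\mathbf{u})=\frac{d\mathbf{u}}{dt}-\mathbf{A}\mathbf{u}$. The bounds compared are the following upper bounds for the projected full-order coarse-scale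 residuals, $\|\tilde{\mathbf{V}}^T\mathbb{P}_G\mathbf{r}_F(\tilde{\mathbf{u}}_F(t))\|_2\le B_G(\tau,t)$ and $\|\tilde{\mathbf{V}}^T\mathbb{P}_A\mathbf{r}_F(\tilde{\mathbf{u}}_F(t))\|_2\le B_A(\tau,t)$, where $$B_G(\tau,t)=\Big\|\tilde{\mathbf{V}}^T\mathbf{A}\int_0^{\tau}e^{\Pi'\mathbf{A}\zeta}\Pi'\mathbf{A}\tilde{\mathbf{u}}_F(t-\zeta)\,d\zeta\Big\|_2+\Big\|\tilde{\mathbf{V}}^T\mathbf{A}\int_{\tau}^{t}e^{\Pi'\mathbf{A}\zeta}\Pi'\mathbf{A}\tilde{\mathbf{u}}_F(t-\zeta)\,d\zeta\Big\|_2,$$ $$B_A(\tau,t)=\Big\|\tilde{\mathbf{V}}^T\mathbf{A}\int_0^{\tau}e^{\Pi'\mathbf{A}\zeta}\Pi'\mathbf{A}\tilde{\mathbf{u}}_F(t-\zeta)\,d\zeta-\tau\tilde{\mathbf{V}}^T\mathbf{A}\Pi'\mathbf{A}\tilde{\mathbf{u}}_F(t)\Big\|_2+\Big\|\tilde{\mathbf{V}}^T\mathbf{A}\int_{\tau}^{t}e^{\Pi'\mathbf{A}\zeta}\Pi'\mathbf{A}\tilde{\mathbf{u}}_F(t-\zeta)\,d\zeta\Big\|_2.$$ *)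

theory Defs
  imports "HOL-Analysis.Analysis"
begin

text \<open>
  An \<open>N \<times> K\<close> real matrix has type \<open>real^'k^'n\<close>, with \<open>N = CARD('n)\<close> and \<open>K = CARD('k)\<close>.
\<close>

definition orthonormal_columns :: "real^'k^'n \<Rightarrow> bool" where
  "orthonormal_columns V \<longleftrightarrow>
     (\<forall>i j. column i V \<bullet> column j V = (if i = j then 1 else 0))"

definition coarse_proj :: "real^'k^'n \<Rightarrow> real^'n^'n" where
  "coarse_proj V = V ** transpose V"

definition fine_proj :: "real^'k^'n \<Rightarrow> real^'n^'n" where
  "fine_proj V = mat 1 - V ** transpose V"

text \<open>
  The overloaded operation \<open>*\<close> on \<open>real^'n^'n\<close> is entrywise, so powers and the
  exponential series are built from the matrix product \<open>**\<close>.
\<close>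

definition matrix_power :: "real^'n^'n \<Rightarrow> nat \<Rightarrow> real^'n^'n" where
  "matrix_power M k = (((**) M) ^^ k) (mat 1)"

definition matrix_exp :: "real^'n^'n \<Rightarrow> real^'n^'n" where
  "matrix_exp M = (\<Sum>k. (1 / fact k) *\<^sub>R matrix_power M k)"

definition memory_integrand ::
    "real^'k^'n \<Rightarrow> real^'n^'n \<Rightarrow> (real \<Rightarrow> real^'n) \<Rightarrow> real \<Rightarrow> real \<Rightarrow> real^'n" where
  "memory_integrand V A w t \<zeta> =
     (matrix_exp (\<zeta> *\<^sub>R (fine_proj V ** A)) ** fine_proj V ** A) *v w (t - \<zeta>)"

text \<open>
  In both bounds \<open>w\<close> is the coarse-scale part of the full-order solution.
  The integrals have their usual meaning for \<open>0 \<le> \<tau> \<le> t\<close>.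
\<close>

definition galerkin_bound ::
    "real^'k^'n \<Rightarrow> real^'n^'n \<Rightarrow> (real \<Rightarrow> real^'n) \<Rightarrow> real \<Rightarrow> real \<Rightarrow> real" where
  "galerkin_bound V A w \<tau> t =
     norm ((transpose V ** A) *v integral {0..\<tau>} (memory_integrand V A w t))
   + norm ((transpose V ** A) *v integral {\<tau>..t} (memory_integrand V A w t))"

definition apg_bound ::
    "real^'k^'n \<Rightarrow> real^'n^'n \<Rightarrow> (real \<Rightarrow> real^'n) \<Rightarrow> real \<Rightarrow> real \<Rightarrow> real" where
  "apg_bound V A w \<tau> t =
     norm ((transpose V ** A) *v integral {0..\<tau>} (memory_integrand V A w t)
           - \<tau> *\<^sub>R ((transpose V ** A ** fine_proj V ** A) *v w t))
   + norm ((transpose V ** A) *v integral {\<tau>..t} (memory_integrand V A w t))"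

end

theory Submission
  imports Defs
begin

text \<open>
  Both bounds share the tail term, the norm of the image under \<open>transpose V ** A\<close> of the memory
  integral over \<open>[\<tau>, t]\<close>; they differ only in the short-memory term over \<open>[0, \<tau>]\<close>. The memory
  integrand is continuous and its value at \<open>\<zeta> = 0\<close> is \<open>fine_proj V ** A *v w t\<close>, so by the
  fundamental theorem of calculus the short-memory integral is this value times \<open>\<tau>\<close>, up to
  \<open>o(\<tau>)\<close>. The term that APG subtracts is exactly the linear part: divided by \<open>\<tau>\<close>, its short-memory
  term tends to \<open>0\<close>, while the Galerkin one tends to the norm of the linear coefficient, which is
  nonnegative.

  The tail term divided by \<open>\<tau>\<close> has a limit in the extended reals by a dichotomy on the integral
  over the whole of \<open>[0, t]\<close>. If its image is nonzero, the quotient diverges to \<open>\<infinity>\<close>. If it is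
  zero, the tail is the negative of the short-memory part and the quotient converges to the same
  finite norm as the Galerkin term (lemma \<open>norm_complement_quotient_tendsto\<close>). In either case
  the two limits are \<open>0 + S\<close> and \<open>c + S\<close> with the same \<open>S \<ge> 0\<close> and a real \<open>c \<ge> 0\<close>, and this is why
  the inequality persists when both are infinite.
\<close>

section \<open>The matrix exponential along a line\<close>

lemma bounded_bilinear_matrix_mult:
  "bounded_bilinear ((**) :: real^'m^'n \<Rightarrow> real^'p^'m \<Rightarrow> real^'p^'n)"
proof -
  have "bilinear ((**) :: real^'m^'n \<Rightarrow> real^'p^'m \<Rightarrow> real^'p^'n)"
    unfolding bilinear_def
    by (auto intro!: linearI simp: matrix_add_ldistrib matrix_matrix_mult_def vec_eq_iff
        sum_distrib_left sum.distrib algebra_simps)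
  then show ?thesis
    by (simp add: bilinear_conv_bounded_bilinear)
qed

lemma bounded_bilinear_matrix_vector_mult:
  "bounded_bilinear ((*v) :: real^'m^'n \<Rightarrow> real^'m \<Rightarrow> real^'n)"
proof -
  have "bilinear ((*v) :: real^'m^'n \<Rightarrow> real^'m \<Rightarrow> real^'n)"
    unfolding bilinear_def
    by (auto intro!: linearI simp: matrix_vector_mult_def vec_eq_iff
        sum_distrib_left sum.distrib algebra_simps)
  then show ?thesis
    by (simp add: bilinear_conv_bounded_bilinear)
qed

lemma matrix_power_0 [simp]: "matrix_power M 0 = mat 1"
  by (simp add: matrix_power_def)

lemma matrix_power_Suc: "matrix_power M (Suc k) = M ** matrix_power M k"
  by (simp add: matrix_power_def)

lemma matrix_power_scaleR:
  "matrix_power (r *\<^sub>R M) k = r ^ k *\<^sub>R matrix_power M k"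
proof (induction k)
  case (Suc k)
  then show ?case
    by (simp add: matrix_power_Suc bounded_bilinear.scaleR_left[OF bounded_bilinear_matrix_mult]
        bounded_bilinear.scaleR_right[OF bounded_bilinear_matrix_mult])
qed simp

text \<open>
  A geometric bound makes the exponential series converge absolutely. It only uses that the
  matrix product is a bounded bilinear map; the bilinear constant \<open>K\<close> is absorbed into the ratio
  \<open>c = norm M * K\<close>.
\<close>

lemma norm_matrix_power_le:
  fixes M :: "real^'n^'n"
  obtains c d :: real where "c \<ge> 0" "\<And>k. norm (matrix_power M k) \<le> d * c ^ k"
proof -
  obtain K where K: "K > 0"
    "\<And>(X :: real^'n^'n) (Y :: real^'n^'n). norm (X ** Y) \<le> norm X * norm Y * K"
    using bounded_bilinear.pos_bounded[OF bounded_bilinear_matrix_mult] by metis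
  have "norm (matrix_power M k) \<le> norm (mat 1 :: real^'n^'n) * (norm M * K) ^ k" for k
  proof (induction k)
    case (Suc k)
    have "norm (matrix_power M (Suc k)) \<le> (norm M * K) * norm (matrix_power M k)"
      using K(2)[of M "matrix_power M k"] by (simp add: matrix_power_Suc mult_ac)
    also have "\<dots> \<le> (norm M * K) * (norm (mat 1 :: real^'n^'n) * (norm M * K) ^ k)"
      using Suc K(1) by (intro mult_left_mono) auto
    finally show ?case by (simp add: mult_ac)
  qed simp
  then show thesis
    using K(1) by (intro that[of "norm M * K"]) auto
qed

text \<open>
  Powers of \<open>r\<close> factor out of the matrix powers, so this is a power series in \<open>r\<close> with matrix
  coefficients; on a bounded interval a scalar exponential series majorizes it uniformly, and the
  continuity of the partial sums passes to the limit.
\<close>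

lemma continuous_on_matrix_exp_scaleR:
  fixes M :: "real^'n^'n"
  shows "continuous_on {a..b} (\<lambda>r. matrix_exp (r *\<^sub>R M))"
proof -
  obtain c d :: real where cd: "c \<ge> 0" "\<And>k. norm (matrix_power M k) \<le> d * c ^ k"
    using norm_matrix_power_le[of M] by blast
  define R where "R = max \<bar>a\<bar> \<bar>b\<bar>"
  have bound: "norm ((1 / fact k) *\<^sub>R matrix_power (r *\<^sub>R M) k) \<le> d * ((R * c) ^ k /\<^sub>R fact k)"
    if "r \<in> {a..b}" for r k
  proof -
    have "\<bar>r\<bar> \<le> R"
      using that by (auto simp: R_def)
    then have "\<bar>r\<bar> ^ k * norm (matrix_power M k) \<le> R ^ k * (d * c ^ k)"
      using cd(2) by (intro mult_mono power_mono) auto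
    then show ?thesis
      by (simp add: matrix_power_scaleR power_abs power_mult_distrib field_simps)
  qed
  have "summable (\<lambda>k. d * ((R * c) ^ k /\<^sub>R fact k))"
    by (intro summable_mult summable_exp_generic)
  then have "uniform_limit {a..b} (\<lambda>n r. \<Sum>k<n. (1 / fact k) *\<^sub>R matrix_power (r *\<^sub>R M) k)
      (\<lambda>r. matrix_exp (r *\<^sub>R M)) sequentially"
    unfolding matrix_exp_def by (intro Weierstrass_m_test[OF bound])
  then show ?thesis
    by (rule uniform_limit_theorem[rotated])
      (auto intro!: always_eventually continuous_intros simp: matrix_power_scaleR)
qed

lemma matrix_exp_0: "matrix_exp (0 :: real^'n^'n) = mat 1"
proof -
  have "(1 / fact k) *\<^sub>R matrix_power (0 :: real^'n^'n) k = 0" if "k \<notin> {0}" for k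
    using that matrix_power_scaleR[of 0 "0 :: real^'n^'n" k] by (simp add: power_0_left)
  then have "matrix_exp (0 :: real^'n^'n) =
      (\<Sum>k\<in>{0}. (1 / fact k) *\<^sub>R matrix_power (0 :: real^'n^'n) k)"
    unfolding matrix_exp_def by (intro suminf_finite) auto
  then show ?thesis by simp
qed

section \<open>The memory integrand\<close>

lemma continuous_on_memory_integrand:
  assumes "continuous_on {0..t} w"
  shows "continuous_on {0..t} (memory_integrand V A w t)"
proof -
  have "continuous_on {0..t} (\<lambda>\<zeta>. w (t - \<zeta>))"
    by (rule continuous_on_compose2[OF assms]) (auto intro!: continuous_intros)
  then show ?thesis
    unfolding memory_integrand_def
    by (intro bounded_bilinear.continuous_on[OF bounded_bilinear_matrix_vector_mult]
        bounded_bilinear.continuous_on[OF bounded_bilinear_matrix_mult]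
        continuous_on_matrix_exp_scaleR continuous_on_const)
qed

lemma memory_integrand_0: "memory_integrand V A w t 0 = (fine_proj V ** A) *v w t"
  by (simp add: memory_integrand_def matrix_exp_0)

section \<open>Quotients as the memory length tends to zero\<close>

lemma integral_quotient_tendsto:
  fixes f :: "real \<Rightarrow> 'a::banach"
  assumes "t > 0" "continuous_on {0..t} f"
  shows "((\<lambda>\<tau>. (1 / \<tau>) *\<^sub>R integral {0..\<tau>} f) \<longlongrightarrow> f 0) (at_right 0)"
proof -
  have "((\<lambda>u. integral {0..u} f) has_vector_derivative f 0) (at 0 within {0..t})"
    using assms by (intro integral_has_vector_derivative) auto
  then have "((\<lambda>\<tau>. (1 / norm \<tau>) *\<^sub>R (integral {0..\<tau>} f - \<tau> *\<^sub>R f 0)) \<longlongrightarrow> 0) (at_right 0)"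
    using assms(1) by (simp add: has_vector_derivative_def has_derivative_within at_within_Icc_at_right)
  moreover have "eventually (\<lambda>\<tau>. (1 / norm \<tau>) *\<^sub>R (integral {0..\<tau>} f - \<tau> *\<^sub>R f 0)
      = (1 / \<tau>) *\<^sub>R integral {0..\<tau>} f - f 0) (at_right (0::real))"
    using eventually_at_right_less[of 0] by eventually_elim (simp add: scaleR_diff_right)
  ultimately have "((\<lambda>\<tau>. (1 / \<tau>) *\<^sub>R integral {0..\<tau>} f - f 0) \<longlongrightarrow> 0) (at_right 0)"
    by (rule Lim_transform_eventually)
  then show ?thesis
    by (rule LIM_zero_cancel)
qed

text \<open>
  Since \<open>h \<tau> / \<tau>\<close> converges, \<open>h \<tau>\<close> tends to \<open>0\<close> and \<open>norm (J - h \<tau>)\<close> tends to \<open>norm J\<close>. For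
  \<open>J \<noteq> 0\<close> the factor \<open>1 / \<tau>\<close> therefore makes the quotient blow up; for \<open>J = 0\<close> only the norm of
  \<open>h \<tau> / \<tau>\<close> remains. It is applied with \<open>J\<close> coming from the integral over \<open>[0, t]\<close> and \<open>h \<tau>\<close> from
  the one over \<open>[0, \<tau>]\<close>, so that \<open>J - h \<tau>\<close> is the tail.
\<close>

lemma norm_complement_quotient_tendsto:
  fixes h :: "real \<Rightarrow> 'a::real_normed_vector"
  assumes "((\<lambda>\<tau>. (1 / \<tau>) *\<^sub>R h \<tau>) \<longlongrightarrow> c) (at_right 0)"
  shows "((\<lambda>\<tau>. ereal (1 / \<tau> * norm (J - h \<tau>))) \<longlongrightarrow> (if J = 0 then ereal (norm c) else \<infinity>)) (at_right 0)"
proof (cases "J = 0")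
  case True
  have "eventually (\<lambda>\<tau>. norm ((1 / \<tau>) *\<^sub>R h \<tau>) = 1 / \<tau> * norm (J - h \<tau>)) (at_right (0::real))"
    using eventually_at_right_less[of 0] by eventually_elim (simp add: True)
  with tendsto_norm[OF assms] have "((\<lambda>\<tau>. 1 / \<tau> * norm (J - h \<tau>)) \<longlongrightarrow> norm c) (at_right 0)"
    by (rule Lim_transform_eventually)
  with True show ?thesis by simp
next
  case False
  have "((\<lambda>\<tau>. \<tau> *\<^sub>R ((1 / \<tau>) *\<^sub>R h \<tau>)) \<longlongrightarrow> 0 *\<^sub>R c) (at_right (0::real))"
    by (intro tendsto_scaleR assms tendsto_ident_at)
  moreover have "eventually (\<lambda>\<tau>. \<tau> *\<^sub>R ((1 / \<tau>) *\<^sub>R h \<tau>) = h \<tau>) (at_right (0::real))"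
    using eventually_at_right_less[of 0] by eventually_elim simp
  ultimately have "(h \<longlongrightarrow> 0) (at_right 0)"
    using Lim_transform_eventually by fastforce
  then have "((\<lambda>\<tau>. norm (J - h \<tau>)) \<longlongrightarrow> norm (J - 0)) (at_right 0)"
    by (intro tendsto_intros)
  then have "LIM \<tau> at_right 0. norm (J - h \<tau>) * inverse \<tau> :> at_top"
    using False by (intro filterlim_tendsto_pos_mult_at_top[OF _ _ filterlim_inverse_at_top_right]) auto
  with False show ?thesis
    by (simp add: tendsto_PInfty_eq_at_top divide_inverse mult.commute)
qed

section \<open>Comparison of the two bounds\<close>

theorem theorem4:
  fixes V :: "real^'k^'n" and A :: "real^'n^'n"
    and u\<^sub>F :: "real \<Rightarrow> real^'n" and u\<^sub>0 :: "real^'n" and T t :: real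
  defines "w \<equiv> \<lambda>s. coarse_proj V *v u\<^sub>F s"
  assumes "CARD('k) \<le> CARD('n)"
    and "T > 0"
    and "orthonormal_columns V"
    and "u\<^sub>0 \<in> range (\<lambda>x. V *v x)"
    and "\<And>s. s \<in> {0..T} \<Longrightarrow> (u\<^sub>F has_vector_derivative A *v u\<^sub>F s) (at s within {0..T})"
    and "u\<^sub>F 0 = u\<^sub>0"
    and "t \<in> {0<..T}"
  shows "\<exists>L\<^sub>A L\<^sub>G :: ereal.
           ((\<lambda>\<tau>. ereal (1 / \<tau> * apg_bound V A w \<tau> t)) \<longlongrightarrow> L\<^sub>A) (at_right 0) \<and>
           ((\<lambda>\<tau>. ereal (1 / \<tau> * galerkin_bound V A w \<tau> t)) \<longlongrightarrow> L\<^sub>G) (at_right 0) \<and>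
           L\<^sub>A \<le> L\<^sub>G"
proof -
  have t: "0 < t" "t \<le> T"
    using assms by auto
  have "continuous_on {0..T} u\<^sub>F"
    using assms(6) by (intro continuous_on_vector_derivative) auto
  then have "continuous_on {0..t} u\<^sub>F"
    by (rule continuous_on_subset) (use t in auto)
  then have "continuous_on {0..t} w"
    unfolding w_def
    by (intro bounded_bilinear.continuous_on[OF bounded_bilinear_matrix_vector_mult] continuous_on_const)
  note cont = continuous_on_memory_integrand[OF this, of V A]
  define f where "f = memory_integrand V A w t"
  define C where "C = transpose V ** A"
  define h where "h \<tau> = C *v integral {0..\<tau>} f" for \<tau>
  define c where "c = C *v f 0"
  define J where "J = h t"
  define S :: ereal where "S = (if J = 0 then ereal (norm c) else \<infinity>)"
  have c_eq: "(transpose V ** A ** fine_proj V ** A) *v w t = c"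
    by (simp add: c_def C_def f_def memory_integrand_0 matrix_vector_mul_assoc matrix_mul_assoc)
  have pos: "eventually (\<lambda>\<tau>. 0 < \<tau> \<and> \<tau> < t) (at_right (0::real))"
    using t by (auto simp: eventually_at_right_field)
  have "((\<lambda>\<tau>. C *v ((1 / \<tau>) *\<^sub>R integral {0..\<tau>} f)) \<longlongrightarrow> c) (at_right 0)"
    unfolding c_def
    by (intro bounded_linear.tendsto[OF matrix_vector_mul_bounded_linear] integral_quotient_tendsto)
      (use t cont in \<open>auto simp: f_def\<close>)
  then have h_lim: "((\<lambda>\<tau>. (1 / \<tau>) *\<^sub>R h \<tau>) \<longlongrightarrow> c) (at_right 0)"
    by (simp add: h_def matrix_vector_mult_scaleR)
  have tail: "C *v integral {\<tau>..t} f = J - h \<tau>" if "0 < \<tau>" "\<tau> < t" for \<tau>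
  proof -
    have "integral {0..\<tau>} f + integral {\<tau>..t} f = integral {0..t} f"
      using that cont
      by (intro Henstock_Kurzweil_Integration.integral_combine integrable_continuous_real)
        (auto simp: f_def)
    then have "J = h \<tau> + C *v integral {\<tau>..t} f"
      by (simp add: J_def h_def flip: matrix_vector_right_distrib)
    then show ?thesis by simp
  qed
  have S_lim: "((\<lambda>\<tau>. ereal (1 / \<tau> * norm (J - h \<tau>))) \<longlongrightarrow> S) (at_right 0)"
    unfolding S_def by (rule norm_complement_quotient_tendsto[OF h_lim])
  have S_nonneg: "0 \<le> S"
    by (simp add: S_def)
  have G_short: "((\<lambda>\<tau>. ereal (norm ((1 / \<tau>) *\<^sub>R h \<tau>))) \<longlongrightarrow> ereal (norm c)) (at_right 0)"
    using tendsto_norm[OF h_lim] by simp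
  have "((\<lambda>\<tau>. norm ((1 / \<tau>) *\<^sub>R h \<tau> - c)) \<longlongrightarrow> 0) (at_right 0)"
    using h_lim by (simp add: tendsto_norm_zero_iff flip: LIM_zero_iff[of _ c])
  then have A_short: "((\<lambda>\<tau>. ereal (norm ((1 / \<tau>) *\<^sub>R h \<tau> - c))) \<longlongrightarrow> 0) (at_right 0)"
    by (simp add: zero_ereal_def)
  have "((\<lambda>\<tau>. ereal (norm ((1 / \<tau>) *\<^sub>R h \<tau> - c)) + ereal (1 / \<tau> * norm (J - h \<tau>))) \<longlongrightarrow> 0 + S) (at_right 0)"
    using A_short S_lim S_nonneg by (intro tendsto_add_ereal_nonneg) auto
  moreover have "eventually (\<lambda>\<tau>. ereal (norm ((1 / \<tau>) *\<^sub>R h \<tau> - c)) + ereal (1 / \<tau> * norm (J - h \<tau>))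
      = ereal (1 / \<tau> * apg_bound V A w \<tau> t)) (at_right 0)"
    using pos
  proof eventually_elim
    case (elim \<tau>)
    then have "(1 / \<tau>) *\<^sub>R h \<tau> - c = (1 / \<tau>) *\<^sub>R (h \<tau> - \<tau> *\<^sub>R c)"
      by (simp add: scaleR_diff_right)
    then have "norm ((1 / \<tau>) *\<^sub>R h \<tau> - c) = 1 / \<tau> * norm (h \<tau> - \<tau> *\<^sub>R c)"
      using elim by simp
    moreover have "apg_bound V A w \<tau> t = norm (h \<tau> - \<tau> *\<^sub>R c) + norm (J - h \<tau>)"
      using elim by (simp add: apg_bound_def tail flip: c_eq C_def f_def h_def)
    ultimately show ?case
      by (simp add: distrib_left)
  qed
  ultimately have A_lim: "((\<lambda>\<tau>. ereal (1 / \<tau> * apg_bound V A w \<tau> t)) \<longlongrightarrow> 0 + S) (at_right 0)"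
    by (rule Lim_transform_eventually)
  have "((\<lambda>\<tau>. ereal (norm ((1 / \<tau>) *\<^sub>R h \<tau>)) + ereal (1 / \<tau> * norm (J - h \<tau>))) \<longlongrightarrow> ereal (norm c) + S) (at_right 0)"
    using G_short S_lim S_nonneg by (intro tendsto_add_ereal_nonneg) auto
  moreover have "eventually (\<lambda>\<tau>. ereal (norm ((1 / \<tau>) *\<^sub>R h \<tau>)) + ereal (1 / \<tau> * norm (J - h \<tau>))
      = ereal (1 / \<tau> * galerkin_bound V A w \<tau> t)) (at_right 0)"
    using pos
  proof eventually_elim
    case (elim \<tau>)
    then have "galerkin_bound V A w \<tau> t = norm (h \<tau>) + norm (J - h \<tau>)"
      by (simp add: galerkin_bound_def tail flip: C_def f_def h_def)
    with elim show ?case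
      by (simp add: distrib_left)
  qed
  ultimately have G_lim: "((\<lambda>\<tau>. ereal (1 / \<tau> * galerkin_bound V A w \<tau> t)) \<longlongrightarrow> ereal (norm c) + S) (at_right 0)"
    by (rule Lim_transform_eventually)
  have "0 + S \<le> ereal (norm c) + S"
    by (intro add_right_mono) simp
  with A_lim G_lim show ?thesis
    by blast
qed

end
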